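(* Let $p$ and $q$ be univariate polynomials over $\mathbb{C}$ of degrees $m$ and $n$, respectively, whose greatest common divisor has degree $k$. Define the holomorphic mapping $$\mathbf{f}:\mathcal{P}_k\times\mathcal{P}_{m-k}\times\mathcal{P}_{n-k}\times\mathcal{P}_m\times\mathcal{P}_n\to\mathcal{P}_m\times\mathcal{P}_n,\qquad (u,v,w,f,g)\mapsto (uv-f,\;uw-g).$$ Then any zero $(\hat u,\hat v,\hat w)$, with $\deg(\hat u)=k$, of the mapping $\mathbf{g}:(u,v,w)\mapsto\mathbf{f}(u,v,w,p,q)$ (at the fixed parameter value $(f,g)=(p,q)$) is semiregular.
   Context: $\mathcal{P}_l$ is the vector space of univariate complex polynomials of degree at most $l$, normed by the Euclidean norm of the coefficient vector, so that $\mathcal{P}_l$ is isometrically isomorphic to $\mathbb{C}^{l+1}$. For a holomorphic mapping $\mathbf{f}:\Omega\subset\mathcal{V}\to\mathcal{W}$ between finite-dimensional normed complex vector spaces, the Jacobian $\mathbf{f}_{\mathbf{x}}(\mathbf{x}_* )$ is its derivative at $\mathbf{x}_*$ as a linear map $\mathcal{V}\to\mathcal{W}$, and the nullity of a linear map is the dimension of its kernel. The dimension of a zero $\mathbf{x}_*$ of $\mathbf{f}$ is $k>0$ if there is an open neighborhood $\Delta\subset\Omega$ of $\mathbf{x}_*$ such that $\Delta\cap\mathbf{f}^{-1}(\mathbf{0})=\phi(\Lambda)$, where $\phi$ is a holomorphic injective mapping defined on a connected open set $\Lambda\subset\mathbb{C}^k$ with $\phi(\mathbf{z}_* )=\mathbf{x}_*$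 and $\mathrm{rank}(\phi_{\mathbf{z}}(\mathbf{z}_* ))=k$ for some $\mathbf z_*\in\Lambda$; an isolated zero has dimension $0$. A zero $\mathbf{x}_*$ is semiregular if its dimension is (well-defined and) identical to the nullity of $\mathbf{f}_{\mathbf{x}}(\mathbf{x}_* )$. *)

theory Defs
  imports
    "HOL-Analysis.Analysis"
    "HOL-Computational_Algebra.Computational_Algebra"
    "HOL-Computational_Algebra.Field_as_Ring"
begin

class complex_normed_vector = real_normed_vector +
  fixes scaleC :: "complex \<Rightarrow> 'a \<Rightarrow> 'a"  (infixr \<open>*\<^sub>C\<close> 75)
  assumes scaleC_add_right: "c *\<^sub>C (x + y) = c *\<^sub>C x + c *\<^sub>C y"
    and scaleC_add_left: "(b + c) *\<^sub>C x = b *\<^sub>C x + c *\<^sub>C x"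
    and scaleC_scaleC: "b *\<^sub>C c *\<^sub>C x = (b * c) *\<^sub>C x"
    and scaleC_one: "1 *\<^sub>C x = x"
    and scaleR_scaleC: "scaleR r x = complex_of_real r *\<^sub>C x"
    and norm_scaleC: "norm (c *\<^sub>C x) = cmod c * norm x"

global_interpretation complex_vector:
  vector_space "scaleC :: complex \<Rightarrow> 'a \<Rightarrow> 'a::complex_normed_vector"
  by unfold_locales (simp_all add: scaleC_add_right scaleC_add_left scaleC_scaleC scaleC_one)

instantiation prod :: (complex_normed_vector, complex_normed_vector) complex_normed_vector
begin

definition scaleC_prod_def: "c *\<^sub>C x = (c *\<^sub>C fst x, c *\<^sub>C snd x)"

instance
proof
  fix r :: real and b c :: complex and x y :: "'a \<times> 'b"
  show "scaleR r x = complex_of_real r *\<^sub>C x"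
    by (simp add: scaleC_prod_def scaleR_prod_def scaleR_scaleC)
  show "norm (c *\<^sub>C x) = cmod c * norm x"
    by (simp add: scaleC_prod_def norm_prod_def norm_scaleC power_mult_distrib real_sqrt_mult
        flip: distrib_left)
qed (simp_all add: scaleC_prod_def scaleC_add_right scaleC_add_left scaleC_scaleC scaleC_one)

end

text \<open>
  The type \<open>complex poly\<close> itself cannot be made an instance of
  \<open>real_normed_vector\<close>: the class \<open>sgn\<close> already has an arity for \<open>poly\<close> that requires
  ordered coefficients.  Hence the copy \<open>cpoly\<close>.
\<close>

typedef cpoly = "UNIV :: complex poly set"
  morphisms poly_of cpoly_of
  by simp

setup_lifting type_definition_cpoly

instantiation cpoly :: comm_ring_1
begin

lift_definition zero_cpoly :: cpoly is 0 .
lift_definition one_cpoly :: cpoly is 1 .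
lift_definition plus_cpoly :: "cpoly \<Rightarrow> cpoly \<Rightarrow> cpoly" is "(+)" .
lift_definition minus_cpoly :: "cpoly \<Rightarrow> cpoly \<Rightarrow> cpoly" is "(-)" .
lift_definition uminus_cpoly :: "cpoly \<Rightarrow> cpoly" is uminus .
lift_definition times_cpoly :: "cpoly \<Rightarrow> cpoly \<Rightarrow> cpoly" is "(*)" .

instance
  by standard (transfer; simp add: algebra_simps)+

end

definition coeff_norm :: "complex poly \<Rightarrow> real" where
  "coeff_norm p = L2_set (\<lambda>i. cmod (coeff p i)) {..degree p}"

lemma coeff_norm_eq:
  assumes "degree p \<le> l"
  shows "coeff_norm p = L2_set (\<lambda>i. cmod (coeff p i)) {..l}"
  unfolding coeff_norm_def L2_set_def
  using assms by (intro arg_cong[where f = sqrt] sum.mono_neutral_left) (auto simp: coeff_eq_0)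

lemma coeff_norm_eq_0_iff: "coeff_norm p = 0 \<longleftrightarrow> p = 0"
proof
  assume "coeff_norm p = 0"
  then have "coeff p (degree p) = 0"
    by (simp add: coeff_norm_def L2_set_eq_0_iff)
  then show "p = 0"
    by simp
qed (simp add: coeff_norm_def)

lemma coeff_norm_triangle: "coeff_norm (p + q) \<le> coeff_norm p + coeff_norm q"
proof -
  define l where "l = max (degree p) (degree q)"
  have "coeff_norm (p + q) = L2_set (\<lambda>i. cmod (coeff p i + coeff q i)) {..l}"
    by (subst coeff_norm_eq[where l = l]) (auto simp: l_def intro: degree_add_le)
  also have "\<dots> \<le> L2_set (\<lambda>i. cmod (coeff p i) + cmod (coeff q i)) {..l}"
    by (intro L2_set_mono norm_triangle_ineq) auto
  also have "\<dots> \<le> L2_set (\<lambda>i. cmod (coeff p i)) {..l} + L2_set (\<lambda>i. cmod (coeff q i)) {..l}"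
    by (rule L2_set_triangle_ineq)
  also have "\<dots> = coeff_norm p + coeff_norm q"
    by (simp add: coeff_norm_eq[where l = l] l_def)
  finally show ?thesis .
qed

lemma coeff_norm_smult: "coeff_norm (smult c p) = cmod c * coeff_norm p"
proof -
  have "coeff_norm (smult c p) = L2_set (\<lambda>i. cmod c * cmod (coeff p i)) {..degree p}"
    by (subst coeff_norm_eq[where l = "degree p"]) (auto simp: norm_mult degree_smult_le)
  then show ?thesis
    by (simp add: coeff_norm_def L2_set_right_distrib)
qed

instantiation cpoly :: complex_normed_vector
begin

lift_definition scaleC_cpoly :: "complex \<Rightarrow> cpoly \<Rightarrow> cpoly" is smult .
lift_definition scaleR_cpoly :: "real \<Rightarrow> cpoly \<Rightarrow> cpoly" is "\<lambda>r. smult (complex_of_real r)" .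
lift_definition norm_cpoly :: "cpoly \<Rightarrow> real" is coeff_norm .

definition sgn_cpoly :: "cpoly \<Rightarrow> cpoly" where "sgn_cpoly x = scaleR (inverse (norm x)) x"
definition dist_cpoly :: "cpoly \<Rightarrow> cpoly \<Rightarrow> real" where "dist_cpoly x y = norm (x - y)"
definition uniformity_cpoly :: "(cpoly \<times> cpoly) filter" where
  "uniformity_cpoly = (INF e\<in>{0<..}. principal {(x, y). dist x y < e})"
definition open_cpoly :: "cpoly set \<Rightarrow> bool" where
  "open_cpoly U = (\<forall>x\<in>U. \<forall>\<^sub>F (x', y) in uniformity. x' = x \<longrightarrow> y \<in> U)"

instance
proof
  fix x y :: cpoly and a b :: real and c d :: complex
  show "a *\<^sub>R (x + y) = a *\<^sub>R x + a *\<^sub>R y" by transfer (simp add: smult_add_right)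
  show "(a + b) *\<^sub>R x = a *\<^sub>R x + b *\<^sub>R x" by transfer (simp add: smult_add_left)
  show "a *\<^sub>R b *\<^sub>R x = (a * b) *\<^sub>R x" by transfer simp
  show "1 *\<^sub>R x = x" by transfer simp
  show "norm x = 0 \<longleftrightarrow> x = 0" by transfer (rule coeff_norm_eq_0_iff)
  show "norm (x + y) \<le> norm x + norm y" by transfer (rule coeff_norm_triangle)
  show "norm (a *\<^sub>R x) = \<bar>a\<bar> * norm x" by transfer (simp add: coeff_norm_smult)
  show "c *\<^sub>C (x + y) = c *\<^sub>C x + c *\<^sub>C y" by transfer (simp add: smult_add_right)
  show "(c + d) *\<^sub>C x = c *\<^sub>C x + d *\<^sub>C x" by transfer (simp add: smult_add_left)
  show "c *\<^sub>C d *\<^sub>C x = (c * d) *\<^sub>C x" by transfer simp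
  show "1 *\<^sub>C x = x" by transfer simp
  show "a *\<^sub>R x = complex_of_real a *\<^sub>C x" by transfer simp
  show "norm (c *\<^sub>C x) = cmod c * norm x" by transfer (rule coeff_norm_smult)
qed (simp_all only: sgn_cpoly_def dist_cpoly_def uniformity_cpoly_def open_cpoly_def)

end

definition poly_space :: "nat \<Rightarrow> cpoly set" where
  "poly_space l = {x. degree (poly_of x) \<le> l}"

text \<open>
  Since the dimension \<open>d\<close> is a number rather than a type below, \<open>\<complex>\<^sup>d\<close> is realised as the space of
  sequences of coefficients that vanish from index \<open>d\<close> on, again with the Euclidean norm.
\<close>

definition coord_space :: "nat \<Rightarrow> cpoly set" where
  "coord_space d = {x. \<forall>i\<ge>d. coeff (poly_of x) i = 0}"

lemma poly_space_eq_coord_space: "poly_space l = coord_space (Suc l)"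
  by (auto simp: poly_space_def coord_space_def Suc_le_eq coeff_eq_0 intro: degree_le)

lemma norm_poly_space:
  "x \<in> poly_space l \<Longrightarrow> norm x = L2_set (\<lambda>i. cmod (coeff (poly_of x) i)) {..l}"
  by (simp add: poly_space_def norm_cpoly.rep_eq coeff_norm_eq)

lemma subspace_coord_space: "complex_vector.subspace (coord_space d)"
  by (auto simp: complex_vector.subspace_def coord_space_def zero_cpoly.rep_eq plus_cpoly.rep_eq
      scaleC_cpoly.rep_eq)

lemma coord_space_eq_span:
  "coord_space d = complex_vector.span ((\<lambda>i. cpoly_of (monom 1 i)) ` {..<d})" (is "_ = ?S d")
proof
  show "?S d \<subseteq> coord_space d"
    by (intro complex_vector.span_minimal subspace_coord_space)
       (auto simp: coord_space_def cpoly_of_inverse)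
  show "coord_space d \<subseteq> ?S d"
  proof
    fix x assume x: "x \<in> coord_space d"
    have *: "poly_of (\<Sum>i\<in>I. c i *\<^sub>C cpoly_of (monom 1 i)) = (\<Sum>i\<in>I. monom (c i) i)"
      if "finite I" for I and c :: "nat \<Rightarrow> complex"
      using that by (induction I rule: finite_induct)
        (auto simp: zero_cpoly.rep_eq plus_cpoly.rep_eq scaleC_cpoly.rep_eq cpoly_of_inverse
          smult_monom)
    have "poly_of x = (\<Sum>i<d. monom (coeff (poly_of x) i) i)"
      using x by (intro poly_eqI) (auto simp: coeff_sum coord_space_def not_less)
    then have "x = (\<Sum>i<d. coeff (poly_of x) i *\<^sub>C cpoly_of (monom 1 i))"
      by (subst poly_of_inject[symmetric]) (simp add: *)
    also have "\<dots> \<in> ?S d"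
      by (intro complex_vector.span_sum complex_vector.span_scale complex_vector.span_base) auto
    finally show "x \<in> ?S d" .
  qed
qed

text \<open>
  In the following, \<open>V\<close> and \<open>W\<close> stand for finite-dimensional complex subspaces of the ambient
  types, and \<open>\<Omega>\<close> for a relatively open subset of \<open>V\<close>.  Derivatives are taken within \<open>\<Omega>\<close>;
  they are then uniquely determined on \<open>V\<close>, and only their restriction to \<open>V\<close> is used.
\<close>

definition holomorphic_map ::
  "'a::complex_normed_vector set \<Rightarrow> 'b::complex_normed_vector set \<Rightarrow> 'a set \<Rightarrow> ('a \<Rightarrow> 'b) \<Rightarrow> bool"
where
  "holomorphic_map V W \<Omega> f \<longleftrightarrow>
     openin (top_of_set V) \<Omega> \<and> f ` \<Omega> \<subseteq> W \<and>
     (\<forall>x\<in>\<Omega>. \<exists>D. (f has_derivative D) (at x within \<Omega>) \<and>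
                 (\<forall>c. \<forall>h\<in>V. D (c *\<^sub>C h) = c *\<^sub>C D h))"

definition jacobian ::
  "'a::complex_normed_vector set \<Rightarrow> ('a \<Rightarrow> 'b::complex_normed_vector) \<Rightarrow> 'a \<Rightarrow> 'a \<Rightarrow> 'b" where
  "jacobian \<Omega> f x = frechet_derivative f (at x within \<Omega>)"

definition nullity_on ::
  "'a::complex_normed_vector set \<Rightarrow> ('a \<Rightarrow> 'b::complex_normed_vector) \<Rightarrow> nat" where
  "nullity_on V L = complex_vector.dim {h \<in> V. L h = 0}"

definition rank_on ::
  "'a::complex_normed_vector set \<Rightarrow> ('a \<Rightarrow> 'b::complex_normed_vector) \<Rightarrow> nat" where
  "rank_on V L = complex_vector.dim (L ` V)"

definition zero_has_dimension ::
  "'a::complex_normed_vector set \<Rightarrow> 'a set \<Rightarrow> ('a \<Rightarrow> 'b::complex_normed_vector) \<Rightarrow> 'a \<Rightarrow> nat \<Rightarrow> bool"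
where
  "zero_has_dimension V \<Omega> f x d \<longleftrightarrow>
     x \<in> \<Omega> \<and> f x = 0 \<and>
     (if d = 0 then x isolated_in {y \<in> \<Omega>. f y = 0}
      else (\<exists>\<Delta> \<Lambda> \<phi> z.
        openin (top_of_set V) \<Delta> \<and> x \<in> \<Delta> \<and> \<Delta> \<subseteq> \<Omega> \<and>
        openin (top_of_set (coord_space d)) \<Lambda> \<and> connected \<Lambda> \<and>
        holomorphic_map (coord_space d) V \<Lambda> \<phi> \<and> inj_on \<phi> \<Lambda> \<and>
        \<Delta> \<inter> {y. f y = 0} = \<phi> ` \<Lambda> \<and>
        z \<in> \<Lambda> \<and> \<phi> z = x \<and> rank_on (coord_space d) (jacobian \<Lambda> \<phi> z) = d))"

text \<open>
  The equivalence for all \<open>d\<close> says both that the dimension of the zero is well-defined (it exists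
  and is unique) and that it equals the nullity of the Jacobian.
\<close>

definition semiregular_zero ::
  "'a::complex_normed_vector set \<Rightarrow> 'b::complex_normed_vector set \<Rightarrow> 'a set \<Rightarrow> ('a \<Rightarrow> 'b) \<Rightarrow> 'a \<Rightarrow> bool"
where
  "semiregular_zero V W \<Omega> f x \<longleftrightarrow>
     holomorphic_map V W \<Omega> f \<and> x \<in> \<Omega> \<and> f x = 0 \<and>
     (\<forall>d. zero_has_dimension V \<Omega> f x d \<longleftrightarrow> d = nullity_on V (jacobian \<Omega> f x))"

definition gcd_map :: "cpoly \<times> cpoly \<times> cpoly \<times> cpoly \<times> cpoly \<Rightarrow> cpoly \<times> cpoly" where
  "gcd_map = (\<lambda>(u, v, w, f, g). (u * v - f, u * w - g))"

definition gcd_map_at :: "complex poly \<Rightarrow> complex poly \<Rightarrow> cpoly \<times> cpoly \<times> cpoly \<Rightarrow> cpoly \<times> cpoly" where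
  "gcd_map_at p q = (\<lambda>(u, v, w). gcd_map (u, v, w, cpoly_of p, cpoly_of q))"

end

(*
  Since deg u equals the degree of the gcd, v and w are coprime.  A kernel vector (a, b, c) of the
  Jacobian satisfies u b + a v = 0 = u c + a w, so u divides a; as deg a \<le> deg u, the kernel is
  spanned by (u, -v, -w).  By the same divisibility argument every zero has the form
  (c u, v / c, w / c) with c \<noteq> 0, and c is a global coordinate on the zero set.  The dimension is
  unique: a parametrisation phi satisfies f o phi = 0, so the image of its derivative lies in the
  kernel of the Jacobian, and the zero is not isolated.
*)

theory Submission
  imports Defs
begin

section \<open>Boundedness of scaling, multiplication and coefficients\<close>

lemma bounded_bilinear_scaleC:
  "bounded_bilinear (scaleC :: complex \<Rightarrow> 'a \<Rightarrow> 'a::complex_normed_vector)"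
proof
  fix a a' :: complex and b b' :: 'a and r :: real
  show "(a + a') *\<^sub>C b = a *\<^sub>C b + a' *\<^sub>C b" by (rule scaleC_add_left)
  show "a *\<^sub>C (b + b') = a *\<^sub>C b + a *\<^sub>C b'" by (rule scaleC_add_right)
  show "(r *\<^sub>R a) *\<^sub>C b = r *\<^sub>R (a *\<^sub>C b)"
    by (simp add: Defs.scaleR_scaleC scaleC_scaleC scaleR_conv_of_real)
  show "a *\<^sub>C (r *\<^sub>R b) = r *\<^sub>R (a *\<^sub>C b)"
    by (simp add: Defs.scaleR_scaleC scaleC_scaleC mult.commute)
  show "\<exists>K. \<forall>a (b::'a). norm (a *\<^sub>C b) \<le> norm a * norm b * K"
    by (intro exI[of _ 1]) (simp add: norm_scaleC)
qed

lemma cmod_coeff_le_norm: "cmod (coeff (poly_of x) i) \<le> norm x"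
proof (cases "i \<le> degree (poly_of x)")
  case True
  then show ?thesis
    unfolding norm_cpoly.rep_eq coeff_norm_def
    by (intro member_le_L2_set) auto
qed (simp add: coeff_eq_0)

lemma coeff_norm_pCons_0: "coeff_norm (pCons 0 p) = coeff_norm p"
  by (subst coeff_norm_eq[where l = "Suc (degree p)"])
     (simp_all add: degree_pCons_le coeff_norm_def L2_set_def sum.atMost_Suc_shift del: sum.atMost_Suc)

text \<open>Horner's scheme: \<open>a = pCons c b\<close> splits off the constant coefficient, and
  multiplication by the variable preserves \<open>coeff_norm\<close>, so the triangle inequality
  contributes one summand per coefficient of \<open>a\<close>.\<close>

lemma coeff_norm_mult_le:
  "degree a \<le> l \<Longrightarrow> coeff_norm (a * h) \<le> (\<Sum>i\<le>l. cmod (coeff a i)) * coeff_norm h"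
proof (induction l arbitrary: a)
  case 0
  then obtain c where "a = [:c:]"
    by (auto elim: degree_eq_zeroE)
  then show ?case
    by (simp add: coeff_norm_smult)
next
  case (Suc l)
  obtain c b where a: "a = pCons c b"
    by (cases a)
  with Suc.prems have b: "degree b \<le> l"
    by (cases "b = 0") auto
  have "coeff_norm (a * h) \<le> coeff_norm (smult c h) + coeff_norm (pCons 0 (b * h))"
    by (simp add: a coeff_norm_triangle)
  also have "\<dots> \<le> cmod c * coeff_norm h + (\<Sum>i\<le>l. cmod (coeff b i)) * coeff_norm h"
    using Suc.IH[OF b] by (simp add: coeff_norm_smult coeff_norm_pCons_0)
  also have "\<dots> = (\<Sum>i\<le>Suc l. cmod (coeff a i)) * coeff_norm h"
    by (simp add: a sum.atMost_Suc_shift algebra_simps del: sum.atMost_Suc)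
  finally show ?case .
qed

text \<open>Each of the l + 1 coefficients of \<open>a\<close> is bounded by its norm. The constant
  depends only on the degree bound, so the estimate is uniform over \<open>poly_space l\<close>, as
  the product rule requires.\<close>

lemma norm_mult_poly_space_le:
  assumes "a \<in> poly_space l"
  shows "norm (a * h) \<le> (real l + 1) * norm a * norm h"
proof -
  have "norm (a * h) \<le> (\<Sum>i\<le>l. cmod (coeff (poly_of a) i)) * norm h"
    using assms coeff_norm_mult_le
    by (simp add: norm_cpoly.rep_eq times_cpoly.rep_eq poly_space_def)
  also have "(\<Sum>i\<le>l. cmod (coeff (poly_of a) i)) \<le> (\<Sum>i\<le>l. norm a)"
    by (intro sum_mono cmod_coeff_le_norm)
  finally show ?thesis
    by (simp add: mult_right_mono algebra_simps)
qed

lemma bounded_linear_mult_cpoly: "bounded_linear (\<lambda>h::cpoly. a * h)"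
proof (rule bounded_linear_intro[where K = "(real (degree (poly_of a)) + 1) * norm a"])
  fix h :: cpoly and r :: real
  show "a * (r *\<^sub>R h) = r *\<^sub>R (a * h)"
    by transfer simp
  show "norm (a * h) \<le> norm h * ((real (degree (poly_of a)) + 1) * norm a)"
    using norm_mult_poly_space_le[of a "degree (poly_of a)" h]
    by (simp add: poly_space_def mult_ac)
qed (simp add: distrib_left)

lemma bounded_linear_coeff: "bounded_linear (\<lambda>x. coeff (poly_of x) i)"
  by (rule bounded_linear_intro[where K = 1])
     (simp_all add: plus_cpoly.rep_eq scaleR_cpoly.rep_eq scaleR_conv_of_real cmod_coeff_le_norm)

section \<open>The polynomial spaces as closed real subspaces\<close>

lemma subspace_real_coord_space: "subspace (coord_space d)"
  by (auto simp: subspace_def coord_space_def zero_cpoly.rep_eq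
      plus_cpoly.rep_eq scaleR_cpoly.rep_eq)

lemma subspace_poly_space: "subspace (poly_space l)"
  by (simp add: poly_space_eq_coord_space subspace_real_coord_space)

text \<open>The space is an intersection of kernels of continuous coefficient functionals.
  Closedness keeps limits of difference quotients inside it.\<close>

lemma closed_poly_space: "closed (poly_space l)"
proof -
  have "closed (\<Inter>i\<in>{Suc l..}. (\<lambda>x. coeff (poly_of x) i) -` {0})"
    by (intro closed_INT ballI closed_vimage closed_singleton
        linear_continuous_on[OF bounded_linear_coeff])
  also have "\<dots> = poly_space l"
    by (auto simp: poly_space_eq_coord_space coord_space_def)
  finally show ?thesis .
qed

lemma scaleC_in_poly_space: "x \<in> poly_space l \<Longrightarrow> c *\<^sub>C x \<in> poly_space l"
  by (auto simp: poly_space_eq_coord_space coord_space_def scaleC_cpoly.rep_eq)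

section \<open>Derivatives within subsets of a subspace, and the product rule\<close>

text \<open>A derivative within \<open>\<Omega>\<close> need not be determined outside
  \<open>V\<close>. Along a line in a direction of \<open>V\<close> it becomes an ordinary
  derivative of one real variable, because the line stays in the relatively open
  \<open>\<Omega>\<close> near 0.\<close>

lemma has_derivative_along_line:
  fixes f :: "'a::real_normed_vector \<Rightarrow> 'b::real_normed_vector"
  assumes V: "subspace V" and \<Omega>: "openin (top_of_set V) \<Omega>" and x: "x \<in> \<Omega>"
    and D: "(f has_derivative D) (at x within \<Omega>)" and h: "h \<in> V"
  shows "((\<lambda>t. f (x + t *\<^sub>R h)) has_derivative (\<lambda>t. t *\<^sub>R D h)) (at 0)"
    and "\<forall>\<^sub>F t in at 0. x + t *\<^sub>R h \<in> \<Omega>"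
proof -
  obtain T where T: "open T" "\<Omega> = V \<inter> T"
    using \<Omega> by (auto simp: openin_open)
  define \<gamma> where "\<gamma> = (\<lambda>t::real. x + t *\<^sub>R h)"
  define S where "S = \<gamma> -` T"
  have S: "open S" "0 \<in> S" "\<gamma> ` S \<subseteq> \<Omega>" "\<gamma> 0 = x"
    using x T h V
    by (auto simp: S_def \<gamma>_def T(2) subspace_add subspace_scale
        intro!: open_vimage continuous_intros)
  have "(\<gamma> has_derivative (\<lambda>t. t *\<^sub>R h)) (at 0 within S)"
    unfolding \<gamma>_def by (auto intro!: derivative_eq_intros)
  moreover have "(f has_derivative D) (at (\<gamma> 0) within \<gamma> ` S)"
    using has_derivative_subset[OF D S(3)] S(4) by simp
  ultimately have "((\<lambda>t. f (\<gamma> t)) has_derivative (\<lambda>t. D (t *\<^sub>R h))) (at 0 within S)"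
    by (rule has_derivative_in_compose)
  then show "((\<lambda>t. f (x + t *\<^sub>R h)) has_derivative (\<lambda>t. t *\<^sub>R D h)) (at 0)"
    using S(1,2) has_derivative_linear[OF D]
    by (simp add: at_within_open[of 0 S] \<gamma>_def linear_scale)
  show "\<forall>\<^sub>F t in at 0. x + t *\<^sub>R h \<in> \<Omega>"
    using S unfolding eventually_at_topological \<gamma>_def by blast
qed

lemma has_derivative_unique_on_subspace:
  fixes f :: "'a::real_normed_vector \<Rightarrow> 'b::real_normed_vector"
  assumes "subspace V" "openin (top_of_set V) \<Omega>" "x \<in> \<Omega>"
    and "(f has_derivative D) (at x within \<Omega>)" "(f has_derivative E) (at x within \<Omega>)"
    and "h \<in> V"
  shows "D h = E h"
proof -
  have "(\<lambda>t. t *\<^sub>R D h) = (\<lambda>t. t *\<^sub>R E h)"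
    by (rule has_derivative_unique; rule has_derivative_along_line) fact+
  from fun_cong[OF this, of 1] show ?thesis
    by simp
qed

text \<open>The vector \<open>D h\<close> is the limit of difference quotients along the line
  through \<open>x\<close> in direction \<open>h\<close>; these lie in \<open>W\<close>, and
  \<open>W\<close> is closed.\<close>

lemma has_derivative_in_closed_subspace:
  fixes f :: "'a::real_normed_vector \<Rightarrow> 'b::real_normed_vector"
  assumes V: "subspace V" "openin (top_of_set V) \<Omega>" "x \<in> \<Omega>"
    and D: "(f has_derivative D) (at x within \<Omega>)" and h: "h \<in> V"
    and W: "subspace W" "closed W" and f: "f ` \<Omega> \<subseteq> W"
  shows "D h \<in> W"
proof -
  let ?q = "\<lambda>t. (f (x + t *\<^sub>R h) - f x) /\<^sub>R t"
  have "((\<lambda>t. norm (f (x + t *\<^sub>R h) - f x - t *\<^sub>R D h) / norm t) \<longlongrightarrow> 0) (at 0)"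
    using has_derivative_along_line(1)[OF V D h] by (simp add: has_derivative_at)
  moreover have "\<forall>\<^sub>F t in at 0. norm (f (x + t *\<^sub>R h) - f x - t *\<^sub>R D h) / norm t = norm (?q t - D h)"
  proof -
    have "norm (f (x + t *\<^sub>R h) - f x - t *\<^sub>R D h) / norm t = norm (?q t - D h)" if "t \<noteq> 0" for t
    proof -
      have "?q t - D h = (f (x + t *\<^sub>R h) - f x - t *\<^sub>R D h) /\<^sub>R t"
        using that by (simp add: scaleR_diff_right)
      then show ?thesis
        by (simp add: divide_inverse mult.commute)
    qed
    then show ?thesis
      by (auto simp: eventually_at_filter)
  qed
  ultimately have "((\<lambda>t. norm (?q t - D h)) \<longlongrightarrow> 0) (at 0)"
    by (rule Lim_transform_eventually)
  then have "(?q \<longlongrightarrow> D h) (at 0)"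
    using Lim_null tendsto_norm_zero_iff by blast
  moreover have "\<forall>\<^sub>F t in at 0. ?q t \<in> W"
    using has_derivative_along_line(2)[OF V D h]
    by eventually_elim (use f V(3) in \<open>auto intro!: subspace_scale subspace_diff W(1)\<close>)
  ultimately show ?thesis
    using W(2) Lim_in_closed_set[of W ?q "at 0"] by (simp add: trivial_limit_at)
qed

text \<open>\<open>frechet_derivative\<close> picks some derivative; two derivatives within
  \<open>\<Omega>\<close> may differ outside \<open>V\<close> but agree on it.\<close>

lemma jacobian_eq:
  assumes "subspace V" "openin (top_of_set V) \<Omega>" "x \<in> \<Omega>"
    and D: "(f has_derivative D) (at x within \<Omega>)" and "h \<in> V"
  shows "jacobian \<Omega> f x h = D h"
proof -
  have "(f has_derivative jacobian \<Omega> f x) (at x within \<Omega>)"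
    unfolding jacobian_def using D by (metis differentiableI frechet_derivative_works)
  then show ?thesis
    using assms has_derivative_unique_on_subspace by blast
qed

lemma derivative_eq_0_on_subspace:
  fixes f :: "'a::real_normed_vector \<Rightarrow> 'b::real_normed_vector"
  assumes V: "subspace V" and \<Omega>: "openin (top_of_set V) \<Omega>" and x: "x \<in> \<Omega>"
    and D: "(f has_derivative D) (at x within \<Omega>)"
    and 0: "\<And>y. y \<in> \<Omega> \<Longrightarrow> f y = 0" and h: "h \<in> V"
  shows "D h = 0"
proof -
  have "(f has_derivative (\<lambda>_. 0)) (at x within \<Omega>)"
    by (rule has_derivative_transform[OF x 0 has_derivative_const])
  from has_derivative_unique_on_subspace[OF V \<Omega> x D this h] show ?thesis .
qed

text \<open>Multiplication is not continuous for the Euclidean norm when the degrees are unbounded,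
  hence the restriction of the first factor.\<close>

lemma has_derivative_mult_poly_space:
  fixes f g :: "'a::real_normed_vector \<Rightarrow> cpoly"
  assumes f: "bounded_linear f" and g: "bounded_linear g"
    and S: "\<And>y. y \<in> S \<Longrightarrow> f y \<in> poly_space l" and x: "x \<in> S"
  shows "((\<lambda>y. f y * g y) has_derivative (\<lambda>h. f x * g h + f h * g x)) (at x within S)"
proof -
  obtain K where K: "\<And>y. norm (f y) \<le> norm y * K" "K \<ge> 0"
    using bounded_linear.nonneg_bounded[OF f] by blast
  obtain L where L: "\<And>y. norm (g y) \<le> norm y * L" "L \<ge> 0"
    using bounded_linear.nonneg_bounded[OF g] by blast
  show ?thesis
  proof (rule has_derivativeI_sandwich[where e = 1 and H = "\<lambda>y. (real l + 1) * K * L * norm (y - x)"])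
    show "bounded_linear (\<lambda>h. f x * g h + f h * g x)"
      unfolding mult.commute[of "f _" "g x"]
      by (intro bounded_linear_add bounded_linear_compose[OF bounded_linear_mult_cpoly] f g)
    have "((\<lambda>y. (real l + 1) * K * L * norm (y - x)) \<longlongrightarrow> (real l + 1) * K * L * norm (x - x)) (at x within S)"
      by (intro tendsto_intros)
    then show "((\<lambda>y. (real l + 1) * K * L * norm (y - x)) \<longlongrightarrow> 0) (at x within S)"
      by simp
    fix y assume y: "y \<in> S" "y \<noteq> x"
    let ?h = "y - x"
    \<comment> \<open>The remainder of the product rule is exactly the product of the two
      increments, hence quadratic in the norm of \<open>?h\<close>.\<close>
    have eq: "f y * g y - f x * g x - (f x * g ?h + f ?h * g x) = f ?h * g ?h"
      by (simp add: linear_diff[OF bounded_linear.linear] f g algebra_simps)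
    have "f ?h \<in> poly_space l"
      using S[OF y(1)] S[OF x]
      by (simp add: linear_diff[OF bounded_linear.linear] f subspace_diff subspace_poly_space)
    then have "norm (f ?h * g ?h) \<le> (real l + 1) * norm (f ?h) * norm (g ?h)"
      by (rule norm_mult_poly_space_le)
    also have "\<dots> \<le> (real l + 1) * (norm ?h * K) * (norm ?h * L)"
      using K L by (intro mult_mono mult_nonneg_nonneg) auto
    finally show "norm (f y * g y - f x * g x - (f x * g ?h + f ?h * g x)) / norm ?h
        \<le> (real l + 1) * K * L * norm ?h"
      using y unfolding eq by (simp add: divide_le_eq mult_ac)
  qed simp
qed

section \<open>The derivative and the zeros of the gcd map\<close>

lemma has_derivative_gcd_map_at:
  assumes \<Omega>: "\<Omega> \<subseteq> poly_space k \<times> UNIV" and x: "(u, v, w) \<in> \<Omega>"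
  shows "(gcd_map_at p q has_derivative (\<lambda>(a, b, c). (u * b + a * v, u * c + a * w)))
    (at (u, v, w) within \<Omega>)"
proof -
  let ?x = "(u, v, w)"
  have 1: "((\<lambda>y::cpoly \<times> cpoly \<times> cpoly. fst y * fst (snd y)) has_derivative
      (\<lambda>h. fst ?x * fst (snd h) + fst h * fst (snd ?x))) (at ?x within \<Omega>)"
    by (rule has_derivative_mult_poly_space[OF bounded_linear_fst
          bounded_linear_fst_comp[OF bounded_linear_snd] _ x])
       (use \<Omega> in auto)
  have 2: "((\<lambda>y::cpoly \<times> cpoly \<times> cpoly. fst y * snd (snd y)) has_derivative
      (\<lambda>h. fst ?x * snd (snd h) + fst h * snd (snd ?x))) (at ?x within \<Omega>)"
    by (rule has_derivative_mult_poly_space[OF bounded_linear_fst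
          bounded_linear_snd_comp[OF bounded_linear_snd] _ x])
       (use \<Omega> in auto)
  have "((\<lambda>y. (fst y * fst (snd y) - cpoly_of p, fst y * snd (snd y) - cpoly_of q)) has_derivative
      (\<lambda>h. (u * fst (snd h) + fst h * v - 0, u * snd (snd h) + fst h * w - 0))) (at ?x within \<Omega>)"
    using 1 2 by (intro has_derivative_Pair has_derivative_diff has_derivative_const) auto
  then show ?thesis
    by (simp add: gcd_map_at_def gcd_map_def case_prod_unfold)
qed

lemma gcd_map_at_eq_0_iff:
  "gcd_map_at p q (a, b, c) = 0 \<longleftrightarrow> poly_of a * poly_of b = p \<and> poly_of a * poly_of c = q"
  by (simp add: gcd_map_at_def gcd_map_def zero_prod_def poly_of_inject[symmetric]
      times_cpoly.rep_eq minus_cpoly.rep_eq zero_cpoly.rep_eq cpoly_of_inverse)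

section \<open>Divisibility and the kernel of the Jacobian\<close>

text \<open>The product of u and gcd(v, w) is a common divisor of u v and u w, whose gcd has only
  the degree of u; this leaves degree 0 for gcd(v, w).\<close>

lemma coprime_cofactors:
  fixes u v w :: "complex poly"
  assumes "u * v \<noteq> 0" "degree (gcd (u * v) (u * w)) = degree u"
  shows "coprime v w"
proof -
  have "u * gcd v w dvd gcd (u * v) (u * w)"
    by simp
  then have "degree (u * gcd v w) \<le> degree u"
    using assms by (metis dvd_imp_degree_le gcd_eq_0_iff)
  moreover have "u \<noteq> 0" "gcd v w \<noteq> 0"
    using assms by auto
  ultimately have "degree (gcd v w) = 0"
    by (simp add: degree_mult_eq)
  with \<open>gcd v w \<noteq> 0\<close> have "is_unit (gcd v w)"
    using \<open>degree (gcd v w) = 0\<close> is_unit_iff_degree by blast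
  then show ?thesis
    by (simp only: is_unit_gcd)
qed

text \<open>For coprime v and w the gcd of a v and a w is a up to a unit, so u divides a, and the
  degrees leave a constant quotient. It serves twice: for kernel vectors, and with the roles of a
  and u exchanged for the other zeros.\<close>

lemma smult_of_dvd_cofactors:
  fixes u v w a :: "complex poly"
  assumes "coprime v w" "u dvd a * v" "u dvd a * w" "degree a \<le> degree u" "u \<noteq> 0"
  obtains t where "a = smult t u"
proof -
  have "u dvd gcd (a * v) (a * w)"
    using assms by simp
  also have "\<dots> = normalize a"
    using assms(1) by (simp add: gcd_mult_left)
  finally obtain s where s: "a = u * s"
    by auto
  have "degree s = 0"
    using assms(4,5) s by (cases "s = 0") (auto simp: degree_mult_eq)
  then obtain t where "s = [:t:]"
    by (auto elim: degree_eq_zeroE)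
  with s that[of t] show ?thesis
    by simp
qed

lemma cpoly_eq_iff: "x = y \<longleftrightarrow> poly_of x = poly_of y"
  by (simp add: poly_of_inject)

text \<open>Both equations make u divide a v and a w, hence a = t u; cancelling u then determines b
  and c.\<close>

lemma gcd_map_kernel:
  assumes cop: "coprime (poly_of v) (poly_of w)" and u: "u \<noteq> 0"
    and a: "degree (poly_of a) \<le> degree (poly_of u)"
    and 1: "u * b + a * v = 0" and 2: "u * c + a * w = 0"
  shows "\<exists>t. (a, b, c) = t *\<^sub>C (u, - v, - w)"
proof -
  have u': "poly_of u \<noteq> 0"
    using u by (simp add: cpoly_eq_iff zero_cpoly.rep_eq)
  have 1: "poly_of u * poly_of b + poly_of a * poly_of v = 0"
    and 2: "poly_of u * poly_of c + poly_of a * poly_of w = 0"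
    using 1 2 by (simp_all add: cpoly_eq_iff zero_cpoly.rep_eq plus_cpoly.rep_eq times_cpoly.rep_eq)
  have "poly_of u dvd poly_of a * poly_of v" "poly_of u dvd poly_of a * poly_of w"
    using 1 2 by (metis dvd_0_right dvd_add_right_iff dvd_triv_left)+
  from smult_of_dvd_cofactors[OF cop this a u'] obtain t where t: "poly_of a = smult t (poly_of u)" .
  have "poly_of u * (poly_of b + smult t (poly_of v)) = 0"
    "poly_of u * (poly_of c + smult t (poly_of w)) = 0"
    using 1 2 by (simp_all add: t algebra_simps)
  then have "poly_of b = - smult t (poly_of v)" "poly_of c = - smult t (poly_of w)"
    using u' by (simp_all add: add_eq_0_iff2)
  with t show ?thesis
    by (intro exI[of _ t])
       (simp add: scaleC_prod_def cpoly_eq_iff scaleC_cpoly.rep_eq uminus_cpoly.rep_eq)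
qed

section \<open>The rescaling curve and the zero set\<close>

text \<open>The orbit of a triple under the action of the nonzero complex numbers that leaves u v
  and u w unchanged. Since \<open>inverse 0 = 0\<close>, the parameter 0 gives the zero triple and
  has to be excluded.\<close>

definition rescaling :: "cpoly \<times> cpoly \<times> cpoly \<Rightarrow> complex \<Rightarrow> cpoly \<times> cpoly \<times> cpoly" where
  "rescaling = (\<lambda>(u, v, w) c. (c *\<^sub>C u, inverse c *\<^sub>C v, inverse c *\<^sub>C w))"

lemma rescaling_1: "rescaling x 1 = x"
  by (cases x) (simp add: rescaling_def scaleC_one)

text \<open>The first component c u alone separates all parameters, including the default value at
  0.\<close>

lemma inj_rescaling: "u \<noteq> 0 \<Longrightarrow> inj (rescaling (u, v, w))"
  by (auto simp: rescaling_def inj_def)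

lemma has_derivative_rescaling:
  assumes "c \<noteq> 0"
  shows "(rescaling (u, v, w) has_derivative
    (\<lambda>h. (h *\<^sub>C u, - (inverse c * h * inverse c) *\<^sub>C v, - (inverse c * h * inverse c) *\<^sub>C w)))
    (at c within S)"
  using assms unfolding rescaling_def prod.case
  by (intro has_derivative_Pair has_derivative_inverse' has_derivative_ident
      bounded_linear.has_derivative[OF bounded_bilinear.bounded_linear_left[OF bounded_bilinear_scaleC]])

lemma continuous_on_rescaling: "continuous_on (- {0}) (rescaling (u, v, w))"
  using has_derivative_rescaling has_derivative_continuous
  by (fastforce simp: continuous_on_eq_continuous_within)

text \<open>If (a, b, c) is another zero, then a divides p = u v and q = u w. Coprimality of v and w
  makes u a multiple of a, and comparing degrees makes the factor a constant.\<close>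

lemma gcd_map_zeros:
  assumes cop: "coprime (poly_of v) (poly_of w)"
    and p: "p \<noteq> 0" "degree p = m" and k: "degree (poly_of u) = k"
    and uvw: "(u, v, w) \<in> poly_space k \<times> poly_space (m - k) \<times> poly_space (n - k)"
    and 0: "gcd_map_at p q (u, v, w) = 0"
  shows "{y \<in> poly_space k \<times> poly_space (m - k) \<times> poly_space (n - k). gcd_map_at p q y = 0}
    = rescaling (u, v, w) ` (- {0})" (is "?Z = ?R")
proof
  have uv: "poly_of u * poly_of v = p" and uw: "poly_of u * poly_of w = q"
    using 0 by (simp_all add: gcd_map_at_eq_0_iff)
  show "?R \<subseteq> ?Z"
    using uvw uv uw
    by (auto simp: rescaling_def gcd_map_at_eq_0_iff scaleC_in_poly_space scaleC_cpoly.rep_eq)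
  show "?Z \<subseteq> ?R"
  proof clarify
    fix a b c
    assume "a \<in> poly_space k" "b \<in> poly_space (m - k)" "c \<in> poly_space (n - k)"
      and "gcd_map_at p q (a, b, c) = 0"
    then have ab: "poly_of a * poly_of b = p" and ac: "poly_of a * poly_of c = q"
      and da: "degree (poly_of a) \<le> k" and db: "degree (poly_of b) \<le> m - k"
      by (simp_all add: gcd_map_at_eq_0_iff poly_space_def)
    \<comment> \<open>The factors of the nonzero p are nonzero, so degrees add up in both
      factorisations.\<close>
    have nz: "poly_of a \<noteq> 0" "poly_of b \<noteq> 0" "poly_of u \<noteq> 0" "poly_of v \<noteq> 0"
      using p ab uv by auto
    have "k \<le> degree (poly_of a)"
      using db p(2) degree_mult_eq[OF nz(1,2)] degree_mult_eq[OF nz(3,4)] unfolding ab uv k by linarith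
    moreover have "poly_of a dvd poly_of u * poly_of v" "poly_of a dvd poly_of u * poly_of w"
      using ab ac uv uw by (metis dvd_triv_left)+
    ultimately obtain t where t: "poly_of u = smult t (poly_of a)"
      using smult_of_dvd_cofactors[OF cop] nz(1) k by metis
    with nz have t0: "t \<noteq> 0"
      by auto
    have "poly_of a * poly_of b = poly_of a * smult t (poly_of v)"
      "poly_of a * poly_of c = poly_of a * smult t (poly_of w)"
      using ab ac uv uw t by auto
    then have "poly_of b = smult t (poly_of v)" "poly_of c = smult t (poly_of w)"
      using nz(1) by (metis mult_left_cancel)+
    \<comment> \<open>As u = t a, b = t v and c = t w, the parameter leading from u to a is the
      inverse of t.\<close>
    with t t0 have "(a, b, c) = rescaling (u, v, w) (inverse t)"
      by (simp add: rescaling_def cpoly_eq_iff scaleC_cpoly.rep_eq)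
    with t0 show "(a, b, c) \<in> ?R"
      by (intro image_eqI[where x = "inverse t"]) auto
  qed
qed

text \<open>Otherwise continuity and injectivity of the curve would make {1} an open subset of the
  complex plane.\<close>

lemma not_isolated_rescaling:
  assumes "u \<noteq> 0"
  shows "\<not> (u, v, w) isolated_in rescaling (u, v, w) ` (- {0})"
proof
  assume "(u, v, w) isolated_in rescaling (u, v, w) ` (- {0})"
  then obtain T where T: "open T" "T \<inter> rescaling (u, v, w) ` (- {0}) = {(u, v, w)}"
    by (auto simp: isolated_in_def)
  have "open (- {0} \<inter> rescaling (u, v, w) -` T)"
    by (intro continuous_open_preimage continuous_on_rescaling T(1)) auto
  also have "- {0} \<inter> rescaling (u, v, w) -` T = {1}"
  proof (intro set_eqI iffI)
    fix c assume "c \<in> - {0} \<inter> rescaling (u, v, w) -` T"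
    then have "rescaling (u, v, w) c \<in> T \<inter> rescaling (u, v, w) ` (- {0})"
      by simp
    then have "rescaling (u, v, w) c = rescaling (u, v, w) 1"
      by (simp add: T(2) rescaling_1)
    then show "c \<in> {1}"
      using inj_rescaling[OF assms] by (simp add: inj_eq)
  qed (use T(2) in \<open>auto simp: rescaling_1\<close>)
  finally show False
    by (simp add: not_open_singleton)
qed

section \<open>The zero has dimension one\<close>

text \<open>One complex coordinate means a constant polynomial: taking coefficient 0 and multiplying
  the polynomial 1 by a scalar are mutually inverse identifications with the complex
  numbers.\<close>

lemma coord_space_1: "x \<in> coord_space 1 \<longleftrightarrow> x = coeff (poly_of x) 0 *\<^sub>C 1"
proof -
  have "poly_of x = [:coeff (poly_of x) 0:]" if "degree (poly_of x) = 0"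
    using that by (auto elim!: degree_eq_zeroE)
  moreover have "degree (poly_of x) = 0" if "poly_of x = [:coeff (poly_of x) 0:]"
    by (subst that) simp
  moreover have "x \<in> coord_space 1 \<longleftrightarrow> degree (poly_of x) = 0"
    using poly_space_eq_coord_space[of 0] by (auto simp: poly_space_def)
  ultimately show ?thesis
    by (simp add: cpoly_eq_iff scaleC_cpoly.rep_eq one_cpoly.rep_eq) blast
qed

lemma coeff_scaleC_1: "coeff (poly_of (c *\<^sub>C 1)) 0 = c"
  by (simp add: scaleC_cpoly.rep_eq one_cpoly.rep_eq)

text \<open>The curve is transported to the punctured line in \<open>coord_space 1\<close>. As it
  covers all zeros in \<open>\<Omega>\<close>, the set \<open>\<Omega>\<close> itself serves as the
  neighborhood, with base parameter 1.\<close>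

lemma zero_has_dimension_rescaling:
  assumes u: "u \<noteq> 0"
    and V: "subspace V" and \<Omega>: "openin (top_of_set V) \<Omega>" and x: "(u, v, w) \<in> \<Omega>"
    and R: "{y \<in> \<Omega>. f y = 0} = rescaling (u, v, w) ` (- {0})"
  shows "zero_has_dimension V \<Omega> f (u, v, w) 1"
proof -
  let ?C = "coord_space 1" and ?x = "(u, v, w)"
  define e where "e = (\<lambda>x. coeff (poly_of x) 0)"
  define \<Lambda> where "\<Lambda> = ?C - {0}"
  define \<phi> where "\<phi> = (\<lambda>s. rescaling ?x (e s))"
  have e: "bounded_linear e"
    unfolding e_def by (rule bounded_linear_coeff)
  have eC: "e (c *\<^sub>C s) = c * e s" for c s
    by (simp add: e_def scaleC_cpoly.rep_eq)
  have e1: "e (c *\<^sub>C 1) = c" for c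
    by (simp add: e_def coeff_scaleC_1)
  have C_eq: "?C = range (\<lambda>c. c *\<^sub>C 1)"
    using coord_space_1 coeff_scaleC_1 by (auto simp del: One_nat_def intro: rangeI)
  have \<Lambda>_eq: "\<Lambda> = (\<lambda>c. c *\<^sub>C 1) ` (- {0})"
    by (auto simp: \<Lambda>_def C_eq simp del: One_nat_def)
  have e_nz: "e s \<noteq> 0" if "s \<in> \<Lambda>" for s
    using that by (auto simp: \<Lambda>_eq e1)
  have "e ` \<Lambda> = - {0}"
    by (auto simp: \<Lambda>_eq image_image e1)
  then have im: "\<phi> ` \<Lambda> = rescaling ?x ` (- {0})"
    by (auto simp: \<phi>_def simp flip: image_image)
  have \<Lambda>: "openin (top_of_set ?C) \<Lambda>"
    unfolding \<Lambda>_def by (simp add: openin_delete)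
  define D where "D = (\<lambda>s h. (e h *\<^sub>C u, - (inverse (e s) * e h * inverse (e s)) *\<^sub>C v,
      - (inverse (e s) * e h * inverse (e s)) *\<^sub>C w))"
  have D: "(\<phi> has_derivative D s) (at s within \<Lambda>)" if "s \<in> \<Lambda>" for s
    unfolding \<phi>_def D_def
    by (rule has_derivative_in_compose[OF bounded_linear_imp_has_derivative[OF e]
        has_derivative_rescaling[OF e_nz[OF that]]])
  have hol: "holomorphic_map ?C V \<Lambda> \<phi>"
    unfolding holomorphic_map_def
  proof (intro conjI ballI exI)
    show "\<phi> ` \<Lambda> \<subseteq> V"
      unfolding im R[symmetric] using openin_imp_subset[OF \<Omega>] by blast
    show "\<forall>c. \<forall>h\<in>?C. D s (c *\<^sub>C h) = c *\<^sub>C D s h" for s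
      by (simp add: D_def eC scaleC_prod_def scaleC_scaleC mult_ac)
  qed (use \<Lambda> D in auto)
  \<comment> \<open>\<open>\<Lambda>\<close> is a continuous image of the punctured plane, which is
    connected because the plane has real dimension 2.\<close>
  have "continuous_on (- {0}) (\<lambda>c. c *\<^sub>C (1::cpoly))"
    by (rule linear_continuous_on[OF bounded_bilinear.bounded_linear_left[OF bounded_bilinear_scaleC]])
  then have conn: "connected \<Lambda>"
    unfolding \<Lambda>_eq by (intro connected_continuous_image connected_punctured_universe) simp_all
  have inj: "inj_on \<phi> \<Lambda>"
    using inj_rescaling[OF u] by (auto simp: \<phi>_def inj_on_def inj_def \<Lambda>_eq e1)
  have one: "1 \<in> \<Lambda>" "e 1 = 1"
    using e1[of 1] by (auto simp: \<Lambda>_eq image_iff scaleC_one intro!: bexI[of _ 1])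
  \<comment> \<open>At parameter 1 all inverses are 1, so the tangent vector is (u, -v, -w), which
    also spans the kernel of the Jacobian of the gcd map.\<close>
  have "jacobian \<Lambda> \<phi> 1 h = e h *\<^sub>C (u, - v, - w)" if "h \<in> ?C" for h
    using jacobian_eq[OF subspace_real_coord_space \<Lambda> one(1) D[OF one(1)] that]
    by (simp add: D_def one scaleC_prod_def)
  then have "jacobian \<Lambda> \<phi> 1 ` ?C = (\<lambda>h. e h *\<^sub>C (u, - v, - w)) ` ?C"
    by (rule image_cong[OF refl])
  also have "\<dots> = range (\<lambda>c. c *\<^sub>C (u, - v, - w))"
    unfolding C_eq image_image e1 ..
  also have "\<dots> = complex_vector.span {(u, - v, - w)}"
    by (simp add: complex_vector.span_singleton)
  finally have rank: "rank_on ?C (jacobian \<Lambda> \<phi> 1) = 1"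
    using u by (simp add: rank_on_def complex_vector.dim_eq_card_independent zero_prod_def)
  have "\<phi> 1 = ?x"
    by (simp add: \<phi>_def one rescaling_1)
  moreover have "\<Omega> \<inter> {y. f y = 0} = \<phi> ` \<Lambda>"
    using R unfolding im by blast
  moreover have "rescaling ?x 1 \<in> {y \<in> \<Omega>. f y = 0}"
    unfolding R by (rule imageI) simp
  then have "f ?x = 0"
    unfolding rescaling_1 by simp
  ultimately show ?thesis
    unfolding zero_has_dimension_def if_not_P[OF one_neq_zero]
    by (intro conjI exI[of _ \<Omega>] exI[of _ \<Lambda>] exI[of _ \<phi>] exI[of _ 1]
        order_refl \<Omega> x \<Lambda> conn hol inj one(1) rank)
qed

section \<open>An upper bound for the dimension of a zero\<close>

text \<open>Differentiating f(\<phi>(s)) = 0 puts the image of the derivative of \<phi> into the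
  kernel of \<open>D\<close>, so its rank \<open>d\<close> is at most the size of a finite spanning
  set.\<close>

lemma zero_has_dimension_le:
  assumes V: "subspace V" "closed V" and fx: "(f has_derivative D) (at x within \<Omega>)"
    and ker: "{h \<in> V. D h = 0} \<subseteq> complex_vector.span B" "finite B"
    and dim: "zero_has_dimension V \<Omega> f x d"
  shows "d \<le> card B"
proof (cases "d = 0")
  case False
  let ?C = "coord_space d"
  obtain \<Delta> \<Lambda> \<phi> z where *: "\<Delta> \<subseteq> \<Omega>" "openin (top_of_set ?C) \<Lambda>" "holomorphic_map ?C V \<Lambda> \<phi>"
    "\<Delta> \<inter> {y. f y = 0} = \<phi> ` \<Lambda>" "z \<in> \<Lambda>" "\<phi> z = x" "rank_on ?C (jacobian \<Lambda> \<phi> z) = d"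
    using dim False unfolding zero_has_dimension_def by auto
  obtain E where E: "(\<phi> has_derivative E) (at z within \<Lambda>)"
    using *(3,5) unfolding holomorphic_map_def by blast
  have "(f has_derivative D) (at (\<phi> z) within \<phi> ` \<Lambda>)"
    using has_derivative_subset[OF fx] * by blast
  from has_derivative_in_compose[OF E this]
  have fE: "((\<lambda>s. f (\<phi> s)) has_derivative (\<lambda>h. D (E h))) (at z within \<Lambda>)" .
  have "jacobian \<Lambda> \<phi> z h \<in> {h \<in> V. D h = 0}" if h: "h \<in> ?C" for h
  proof -
    have "D (E h) = 0"
      by (rule derivative_eq_0_on_subspace[OF subspace_real_coord_space *(2,5) fE _ h]) (use * in auto)
    \<comment> \<open>The kernel is taken inside \<open>V\<close>, so \<open>E h\<close> has to lie
      in \<open>V\<close> as well; this is where closedness of \<open>V\<close> enters.\<close>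
    moreover have "E h \<in> V"
      using has_derivative_in_closed_subspace[OF subspace_real_coord_space *(2,5) E h V] *(3)
      by (simp add: holomorphic_map_def)
    ultimately show ?thesis
      using jacobian_eq[OF subspace_real_coord_space *(2,5) E h] by simp
  qed
  then have "jacobian \<Lambda> \<phi> z ` ?C \<subseteq> complex_vector.span B"
    using ker by blast
  from complex_vector.dim_le_card[OF this ker(2)] show ?thesis
    using *(7) by (simp add: rank_on_def)
qed simp

theorem lemma3:
  fixes p q :: "complex poly" and m n k :: nat and u v w :: cpoly
  assumes "p \<noteq> 0" "degree p = m"
    and "q \<noteq> 0" "degree q = n"
    and "degree (gcd p q) = k"
    and "(u, v, w) \<in> poly_space k \<times> poly_space (m - k) \<times> poly_space (n - k)"
    and "gcd_map_at p q (u, v, w) = 0"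
    and "degree (poly_of u) = k"
  shows "semiregular_zero
           (poly_space k \<times> poly_space (m - k) \<times> poly_space (n - k))
           (poly_space m \<times> poly_space n)
           (poly_space k \<times> poly_space (m - k) \<times> poly_space (n - k))
           (gcd_map_at p q) (u, v, w)"
proof -
  let ?V = "poly_space k \<times> poly_space (m - k) \<times> poly_space (n - k)"
  let ?f = "gcd_map_at p q" and ?x = "(u, v, w)"
  define D where "D = (\<lambda>(u, v, w) (a, b, c). (u * b + a * v, u * c + a * w) :: cpoly \<times> cpoly)"
  have uv: "poly_of u * poly_of v = p" and uw: "poly_of u * poly_of w = q"
    using assms(7) by (simp_all add: gcd_map_at_eq_0_iff)
  have u: "u \<noteq> 0"
    using uv assms(1) by (auto simp: zero_cpoly.rep_eq)
  \<comment> \<open>The factor u already has the full degree k of the gcd of p and q.\<close>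
  have cop: "coprime (poly_of v) (poly_of w)"
    using coprime_cofactors[of "poly_of u" "poly_of v" "poly_of w"] assms by (simp add: uv uw)
  have km: "k \<le> m" and kn: "k \<le> n"
    using assms(1-5) by (auto intro: dvd_imp_degree_le)
  have V: "subspace ?V"
    by (intro subspace_Times subspace_poly_space)
  have D: "(?f has_derivative D y) (at y within ?V)" if "y \<in> ?V" for y
    using that has_derivative_gcd_map_at[of ?V k] unfolding D_def by (cases y) (auto simp: Sigma_mono)
  have hol: "holomorphic_map ?V (poly_space m \<times> poly_space n) ?V ?f"
    unfolding holomorphic_map_def
  proof (intro conjI ballI exI)
    \<comment> \<open>The assumption k \<le> l makes the subtraction of naturals exact, so the
      degrees of a and b add up to at most l.\<close>
    have "degree (a * b - r) \<le> l" if "degree a \<le> k" "degree b \<le> l - k" "k \<le> l" "degree r \<le> l"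
      for a b r :: "complex poly" and l
      using that degree_mult_le[of a b] by (intro degree_diff_le) auto
    then show "?f ` ?V \<subseteq> poly_space m \<times> poly_space n"
      using km kn assms(2,4)
      by (auto simp: gcd_map_at_def gcd_map_def poly_space_def minus_cpoly.rep_eq times_cpoly.rep_eq
          cpoly_of_inverse)
    show "\<forall>c. \<forall>h\<in>?V. D y (c *\<^sub>C h) = c *\<^sub>C D y h" for y
      by (auto simp: D_def scaleC_prod_def cpoly_eq_iff times_cpoly.rep_eq plus_cpoly.rep_eq
          scaleC_cpoly.rep_eq smult_add_right split: prod.splits)
    show "(?f has_derivative D y) (at y within ?V)" if "y \<in> ?V" for y
      using that by (rule D)
  qed auto
  have ker: "{h \<in> ?V. D ?x h = 0} = complex_vector.span {(u, -v, -w)}"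
  proof
    show "{h \<in> ?V. D ?x h = 0} \<subseteq> complex_vector.span {(u, -v, -w)}"
      using gcd_map_kernel[OF cop u] assms(8)
      by (auto simp: D_def zero_prod_def complex_vector.span_singleton poly_space_def image_iff)
    show "complex_vector.span {(u, -v, -w)} \<subseteq> {h \<in> ?V. D ?x h = 0}"
      using assms(6)
      by (auto simp: D_def zero_prod_def complex_vector.span_singleton scaleC_prod_def
          scaleC_in_poly_space subspace_neg subspace_poly_space cpoly_eq_iff times_cpoly.rep_eq
          plus_cpoly.rep_eq minus_cpoly.rep_eq zero_cpoly.rep_eq scaleC_cpoly.rep_eq uminus_cpoly.rep_eq)
  qed
  have "{h \<in> ?V. jacobian ?V ?f ?x h = 0} = {h \<in> ?V. D ?x h = 0}"
    using jacobian_eq[OF V _ assms(6) D[OF assms(6)]] by auto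
  then have "nullity_on ?V (jacobian ?V ?f ?x) = complex_vector.dim {(u, - v, - w)}"
    unfolding nullity_on_def ker by (simp only: complex_vector.dim_span)
  then have nullity: "nullity_on ?V (jacobian ?V ?f ?x) = 1"
    using u by (simp add: complex_vector.dim_eq_card_independent zero_prod_def)
  have Z: "{y \<in> ?V. ?f y = 0} = rescaling ?x ` (- {0})"
    using gcd_map_zeros[OF cop assms(1,2,8,6,7)] .
  have 1: "zero_has_dimension ?V ?V ?f ?x 1"
    by (rule zero_has_dimension_rescaling[OF u V _ assms(6) Z]) simp
  \<comment> \<open>Uniqueness of the dimension: the one-dimensional kernel bounds \<open>d\<close>
    by 1, and 0 would mean an isolated zero although the curve passes through it.\<close>
  have "d = 1" if d: "zero_has_dimension ?V ?V ?f ?x d" for d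
  proof -
    have "closed ?V"
      by (intro closed_Times closed_poly_space)
    from zero_has_dimension_le[OF V this D[OF assms(6)], of "{(u, - v, - w)}"] ker d
    have "d \<le> 1"
      by simp
    moreover have "d \<noteq> 0"
    proof
      assume "d = 0"
      with d have "?x isolated_in {y \<in> ?V. ?f y = 0}"
        unfolding zero_has_dimension_def by simp
      then show False
        unfolding Z using not_isolated_rescaling[OF u] by blast
    qed
    ultimately show ?thesis
      by simp
  qed
  with 1 show ?thesis
    unfolding semiregular_zero_def nullity using hol assms(6,7) by metis
qed

end
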